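(* Let $n_0 = 3\cdot 5\cdot 7\cdot 11\cdot 13\cdot 17\cdot 19\cdot 23 = 111546435$. The number of conflicts in the partition $$\{\,S_{1,n_0}\cup\{n_0\},\ S_{2,n_0}\setminus\{n_0\}\,\}\cup\{S_{j,n_0} : j\ge 3,\ S_{j,n_0}\neq\emptyset\}$$ of $\{2,3,\dots,n_0\}$ is strictly less than the number of conflicts in the partition $$\{S_{j,n_0} : j\ge 1,\ S_{j,n_0}\neq\emptyset\}$$ of $\{2,3,\dots,n_0\}$. In particular, the latter partition does not have the minimal number of conflicts among all partitions of $\{2,\dots,n_0\}$.
   Context: Let $p_i$ denote the $i$-th prime ($p_1=2$, $p_2=3,\dots$). For $i\ge1$ and a positive integer $n$, $S_{i,n}$ is the set of positive integers $m\le n$ with $p_i\mid m$ and $p_j\nmid m$ for all $j<i$. Two distinct integers $a,b\ge 2$ are friends if $\gcd(a,b)>1$ and enemies if $\gcd(a,b)=1$. Given a partition of a finite set of integers $\ge2$, a pair $\{a,b\}$ of distinct elements is in conflict if $a,b$ are enemies lying in the same class, or friends lying in different classes. The number of conflicts of a partition is the number of such unordered pairs. *)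

theory Defs
  imports "HOL-Computational_Algebra.Primes" "HOL-Library.Infinite_Set" "HOL-Library.Disjoint_Sets"
begin

(* Indexing is 1-based (nth_prime 1 = 2), whereas enumerate counts from 0.
   The value at index 0 is a junk value and is never used. *)
definition nth_prime :: "nat \<Rightarrow> nat" where
  "nth_prime i = enumerate {p. prime p} (i - 1)"

definition S_block :: "nat \<Rightarrow> nat \<Rightarrow> nat set" where
  "S_block i n = {m. 1 \<le> m \<and> m \<le> n \<and> nth_prime i dvd m \<and>
     (\<forall>j. 1 \<le> j \<and> j < i \<longrightarrow> \<not> nth_prime j dvd m)}"

definition friends :: "nat \<Rightarrow> nat \<Rightarrow> bool" where
  "friends a b \<longleftrightarrow> a \<ge> 2 \<and> b \<ge> 2 \<and> a \<noteq> b \<and> gcd a b > 1"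

definition enemies :: "nat \<Rightarrow> nat \<Rightarrow> bool" where
  "enemies a b \<longleftrightarrow> a \<ge> 2 \<and> b \<ge> 2 \<and> a \<noteq> b \<and> gcd a b = 1"

definition in_conflict :: "nat set set \<Rightarrow> nat \<Rightarrow> nat \<Rightarrow> bool" where
  "in_conflict P a b \<longleftrightarrow>
     (enemies a b \<and> (\<exists>C\<in>P. a \<in> C \<and> b \<in> C)) \<or>
     (friends a b \<and> (\<exists>C\<in>P. \<exists>D\<in>P. C \<noteq> D \<and> a \<in> C \<and> b \<in> D))"

(* Counts unordered pairs: each pair is the two-element set {a, b}. *)
definition num_conflicts :: "nat set set \<Rightarrow> nat" where
  "num_conflicts P = card {{a, b} | a b. in_conflict P a b}"

definition has_min_conflicts :: "nat set \<Rightarrow> nat set set \<Rightarrow> bool" where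
  "has_min_conflicts A P \<longleftrightarrow> partition_on A P \<and>
     (\<forall>Q. partition_on A Q \<longrightarrow> num_conflicts P \<le> num_conflicts Q)"

end

(* The two partitions differ only in the class of n0, so only pairs {n0, m} matter.
   Moving n0 from S_2 to S_1 removes the conflicts with its even friends and creates conflicts
   with its even enemies and with the other elements of S_2.  The reflection m -> n0 - m exchanges
   the even and the odd numbers coprime to n0, so n0 has totient n0 / 2 = 18247680 even enemies and
   55773217 - 18247680 = 37525537 even friends, while S_2 - {n0} has 18591072 elements;
   and 18247680 + 18591072 < 37525537. *)
theory Submission
  imports Defs "HOL-Number_Theory.Totient"
begin

definition fibres :: "('a \<Rightarrow> 'b) \<Rightarrow> 'a set \<Rightarrow> 'a set set" where
  "fibres f A = (\<lambda>x. {y \<in> A. f y = f x}) ` A"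

lemma partition_on_fibres: "partition_on A (fibres f A)"
  by (rule partition_onI) (auto simp: fibres_def disjnt_def)

text \<open>Brings \<open>fibres\<close> into the indexed form, with empty classes left out, in
  which \<open>P\<close> and most of \<open>P'\<close> are given.\<close>

lemma fibres_eq: "fibres f A = {{y \<in> A. f y = j} | j. {y \<in> A. f y = j} \<noteq> {}}"
  by (auto simp: fibres_def image_iff)

text \<open>Every element of \<open>A\<close> lies in exactly one fibre, so the quantifiers over
  classes collapse to a comparison of labels.\<close>

lemma in_conflict_fibres:
  "in_conflict (fibres f A) a b \<longleftrightarrow>
     a \<in> A \<and> b \<in> A \<and> (enemies a b \<and> f a = f b \<or> friends a b \<and> f a \<noteq> f b)"
proof -
  have "(\<exists>C\<in>fibres f A. a \<in> C \<and> b \<in> C) \<longleftrightarrow> a \<in> A \<and> b \<in> A \<and> f a = f b"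
    by (auto simp: fibres_def)
  moreover have "(\<exists>C\<in>fibres f A. \<exists>D\<in>fibres f A. C \<noteq> D \<and> a \<in> C \<and> b \<in> D)
      \<longleftrightarrow> a \<in> A \<and> b \<in> A \<and> f a \<noteq> f b"
    by (auto simp: fibres_def)
  ultimately show ?thesis
    by (auto simp: in_conflict_def)
qed

text \<open>A pair through \<open>x\<close> is determined by its other element, so these pairs are
  counted by the \<open>R\<close>-neighbours of \<open>x\<close>.\<close>

lemma card_pairs_split:
  fixes R :: "'a \<Rightarrow> 'a \<Rightarrow> bool"
  assumes "finite A" and R_in: "\<And>a b. R a b \<Longrightarrow> a \<in> A \<and> b \<in> A \<and> a \<noteq> b"
    and sym: "\<And>a b. R a b \<Longrightarrow> R b a"
  shows "card {{a, b} | a b. R a b} =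
    card {{a, b} | a b. R a b \<and> a \<noteq> x \<and> b \<noteq> x} + card {b. R x b}"
proof -
  have "{{a, b} | a b. R a b} =
      {{a, b} | a b. R a b \<and> a \<noteq> x \<and> b \<noteq> x} \<union> (\<lambda>b. {x, b}) ` {b. R x b}"
    (is "_ = ?U \<union> ?V")
  proof (intro equalityI subsetI)
    fix z assume "z \<in> {{a, b} | a b. R a b}"
    then obtain a b where z: "z = {a, b}" "R a b" by blast
    consider "a = x" | "b = x" | "a \<noteq> x" "b \<noteq> x" by blast
    then show "z \<in> ?U \<union> ?V"
    proof cases
      \<comment> \<open>A pair listed with \<open>x\<close> in second place is turned around by
        symmetry.\<close>
      case 2
      then have "z = {x, a}" "R x a" using z sym by auto
      then show ?thesis by blast
    qed (use z in blast)+
  qed blast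
  moreover have "finite ?U"
    by (rule finite_subset[of _ "Pow A"]) (use R_in \<open>finite A\<close> in auto)
  moreover have "finite ?V"
    by (rule finite_subset[of _ "Pow A"]) (use R_in \<open>finite A\<close> in auto)
  moreover have "x \<notin> z" if "z \<in> ?U" for z using that by blast
  then have "?U \<inter> ?V = {}" by (metis (no_types, lifting) disjoint_iff imageE insertI1)
  moreover have "card ?V = card {b. R x b}"
    by (rule card_image) (auto simp: inj_on_def doubleton_eq_iff)
  ultimately show ?thesis
    by (simp add: card_Un_disjoint)
qed

text \<open>Pairs avoiding \<open>x\<close> have the same labels under \<open>f\<close> and
  \<open>g\<close>, hence the same conflicts; only the conflicts of \<open>x\<close> itself remain
  to be compared.\<close>

lemma num_conflicts_fibres_less:
  assumes "finite A" and agree: "\<And>y. y \<noteq> x \<Longrightarrow> f y = g y"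
    and less: "card {b. in_conflict (fibres f A) x b} < card {b. in_conflict (fibres g A) x b}"
  shows "num_conflicts (fibres f A) < num_conflicts (fibres g A)"
proof -
  have split: "num_conflicts (fibres h A) =
      card {{a, b} | a b. in_conflict (fibres h A) a b \<and> a \<noteq> x \<and> b \<noteq> x}
      + card {b. in_conflict (fibres h A) x b}" for h
    unfolding num_conflicts_def
    by (rule card_pairs_split[OF \<open>finite A\<close>])
      (auto simp: in_conflict_fibres enemies_def friends_def gcd.commute)
  have "in_conflict (fibres f A) a b \<and> a \<noteq> x \<and> b \<noteq> x \<longleftrightarrow>
      in_conflict (fibres g A) a b \<and> a \<noteq> x \<and> b \<noteq> x" for a b
    using agree by (auto simp: in_conflict_fibres)
  then show ?thesis
    using less by (simp add: split)
qed

section \<open>The blocks as fibres of the index of the least prime divisor\<close>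

lemma nth_prime_1: "nth_prime 1 = 2"
  by (auto simp: nth_prime_def enumerate_0 intro!: Least_equality prime_ge_2_nat)

lemma nth_prime_2: "nth_prime 2 = 3"
proof -
  have "(LEAST n::nat. prime n) = 2"
    by (auto intro!: Least_equality prime_ge_2_nat)
  moreover have "(LEAST n::nat. prime n \<and> n \<noteq> 2) = 3"
  proof (rule Least_equality)
    fix y :: nat assume "prime y \<and> y \<noteq> 2"
    then show "3 \<le> y" using prime_ge_2_nat[of y] by linarith
  qed simp
  ultimately show ?thesis
    by (simp add: nth_prime_def enumerate_Suc enumerate_0)
qed

lemma ex_nth_prime_dvd:
  assumes "m \<ge> 2"
  shows "\<exists>j\<ge>1. nth_prime j dvd m"
proof -
  obtain p where p: "prime p" "p dvd m"
    using assms prime_factor_nat[of m] by auto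
  then obtain k where "enumerate {p::nat. prime p} k = p"
    using enumerate_Ex[of "{p::nat. prime p}"] primes_infinite by blast
  then have "nth_prime (Suc k) dvd m"
    using p by (simp add: nth_prime_def)
  then show ?thesis by (intro exI[of _ "Suc k"]) simp
qed

text \<open>Keeps 1 out of every block: \<open>S_block\<close> admits all \<open>m \<ge> 1\<close>,
  whereas the partitions live on \<open>{2..n}\<close>.\<close>

lemma nth_prime_not_dvd_1: "j \<ge> 1 \<Longrightarrow> \<not> nth_prime j dvd 1"
  using enumerate_in_set[OF primes_infinite, of "j - 1"]
  by (auto simp: nth_prime_def dest: prime_gt_1_nat)

text \<open>The bound \<open>1 \<le> j\<close> matters: truncated subtraction makes
  \<open>nth_prime 0\<close> equal to 2 as well, so even numbers would otherwise get label
  0.\<close>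

definition least_prime_index :: "nat \<Rightarrow> nat" where
  "least_prime_index m = (LEAST j. 1 \<le> j \<and> nth_prime j dvd m)"

lemma least_prime_index_eq_iff:
  assumes "m \<ge> 2"
  shows "least_prime_index m = j \<longleftrightarrow>
    1 \<le> j \<and> nth_prime j dvd m \<and> (\<forall>i. 1 \<le> i \<and> i < j \<longrightarrow> \<not> nth_prime i dvd m)"
proof
  assume "least_prime_index m = j"
  then show "1 \<le> j \<and> nth_prime j dvd m \<and> (\<forall>i. 1 \<le> i \<and> i < j \<longrightarrow> \<not> nth_prime i dvd m)"
    using LeastI_ex[OF ex_nth_prime_dvd[OF assms]] not_less_Least
    unfolding least_prime_index_def by blast
next
  assume "1 \<le> j \<and> nth_prime j dvd m \<and> (\<forall>i. 1 \<le> i \<and> i < j \<longrightarrow> \<not> nth_prime i dvd m)"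
  then show "least_prime_index m = j"
    unfolding least_prime_index_def by (intro Least_equality) (auto simp: not_less[symmetric])
qed

lemma least_prime_index_eq_1: "m \<ge> 2 \<Longrightarrow> least_prime_index m = 1 \<longleftrightarrow> even m"
  by (auto simp: least_prime_index_eq_iff nth_prime_1[unfolded One_nat_def])

lemma least_prime_index_eq_2: "m \<ge> 2 \<Longrightarrow> least_prime_index m = 2 \<longleftrightarrow> odd m \<and> 3 dvd m"
proof -
  have "1 \<le> i \<and> i < 2 \<longleftrightarrow> i = 1" for i :: nat by auto
  then show "m \<ge> 2 \<Longrightarrow> ?thesis"
    by (auto simp: least_prime_index_eq_iff nth_prime_1[unfolded One_nat_def] nth_prime_2)
qed

lemma S_block_eq_fibre:
  assumes "j \<ge> 1"
  shows "S_block j n = {m \<in> {2..n}. least_prime_index m = j}"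
proof -
  have ge_2: "m \<ge> 2" if "m \<ge> 1" "nth_prime j dvd m" for m
    using nth_prime_not_dvd_1[OF assms] that by (cases "m = 1") auto
  have "m \<in> S_block j n \<longleftrightarrow> m \<in> {2..n} \<and> least_prime_index m = j" for m
  proof (cases "m \<ge> 2")
    case True
    then show ?thesis
      using assms by (auto simp only: S_block_def least_prime_index_eq_iff[OF True]
          mem_Collect_eq atLeastAtMost_iff)
  next
    case False
    then show ?thesis using ge_2[of m] by (auto simp: S_block_def)
  qed
  then show ?thesis by blast
qed

section \<open>Counting even numbers, odd multiples of 3 and totatives\<close>

text \<open>For odd \<open>n\<close> the reflection at \<open>n\<close> flips parity and preserves
  coprimality to \<open>n\<close>, so half of the totatives are even.\<close>

lemma card_even_coprime:
  fixes n :: nat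
  assumes "odd n" "n > 1"
  shows "2 * card {m \<in> {2..n}. even m \<and> coprime n m} = totient n"
proof -
  let ?E = "{m \<in> {2..n}. even m \<and> coprime n m}" and ?O = "{m \<in> {1..n}. odd m \<and> coprime n m}"
  have refl: "coprime n (n - m) \<longleftrightarrow> coprime n m" if "m \<le> n" for m
    using gcd_diff2_nat[OF that] by (simp add: coprime_iff_gcd_eq_1 gcd.commute[of n])
  have not_self: "\<not> coprime n n" using assms by simp
  have "bij_betw (\<lambda>m. n - m) ?E ?O"
  proof (rule bij_betw_byWitness[where f' = "\<lambda>m. n - m"])
    show "(\<lambda>m. n - m) ` ?E \<subseteq> ?O"
      using assms refl by (auto simp: Suc_le_eq intro!: Nat.gr0I)
    show "(\<lambda>m. n - m) ` ?O \<subseteq> ?E"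
    proof
      fix k assume "k \<in> (\<lambda>m. n - m) ` ?O"
      then obtain m where m: "k = n - m" "m \<in> ?O" by blast
      \<comment> \<open>The case \<open>m = n\<close> would reflect to 0, which lies outside
        \<open>?E\<close>.\<close>
      then have "m \<noteq> n" using not_self by auto
      then have "even k" "k > 0" using m assms by auto
      then have "k \<ge> 2" by presburger
      then show "k \<in> ?E" using m refl \<open>even k\<close> by auto
    qed
  qed auto
  then have "card ?E = card ?O" by (rule bij_betw_same_card)
  moreover have "totatives n = ?E \<union> ?O"
  proof -
    have "m \<in> totatives n \<longleftrightarrow> m \<in> ?E \<union> ?O" for m
    proof -
      have "even m \<Longrightarrow> m > 0 \<Longrightarrow> m \<ge> 2" by presburger
      then show ?thesis
        using coprime_commute[of m n] unfolding in_totatives_iff by auto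
    qed
    then show ?thesis by blast
  qed
  moreover have "?E \<inter> ?O = {}" by auto
  ultimately show ?thesis
    by (simp add: totient_def card_Un_disjoint)
qed

lemma card_even_atLeastAtMost: "card {m \<in> {2..n}. even m} = n div 2" for n :: nat
proof -
  have "{m \<in> {2..n}. even m} = (*) 2 ` {1..n div 2}"
    by (auto elim!: evenE simp: image_iff)
  then show ?thesis by (simp add: card_image inj_on_def)
qed

text \<open>The odd multiples of 3 are the numbers \<open>6 * k + 3\<close>, and
  \<open>6 * k + 3 \<le> n\<close> means \<open>k + 1 \<le> (n + 3) div 6\<close>.\<close>

lemma card_odd_multiples_3: "card {m \<in> {2..n}. odd m \<and> 3 dvd m} = (n + 3) div 6" for n :: nat
proof -
  have "{m \<in> {2..n}. odd m \<and> 3 dvd m} = (\<lambda>k. 6 * k + 3) ` {..<(n + 3) div 6}"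
  proof (intro equalityI subsetI)
    fix m assume m: "m \<in> {m \<in> {2..n}. odd m \<and> 3 dvd m}"
    then obtain a where a: "m = 3 * a" by (auto elim: dvdE)
    with m have "odd a" by simp
    then obtain k where "a = 2 * k + 1" by (rule oddE)
    with a have k: "m = 6 * k + 3" by simp
    then have "k < (n + 3) div 6" using m by auto
    then show "m \<in> (\<lambda>k. 6 * k + 3) ` {..<(n + 3) div 6}" using k by blast
  next
    fix m assume "m \<in> (\<lambda>k. 6 * k + 3) ` {..<(n + 3) div 6}"
    then obtain k where "m = 6 * k + 3" "k < (n + 3) div 6" by blast
    then show "m \<in> {m \<in> {2..n}. odd m \<and> 3 dvd m}" by simp
  qed
  then show ?thesis by (simp add: card_image inj_on_def)
qed

text \<open>The number is squarefree, so its totient is the product of the \<open>p - 1\<close>,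
  built up along the partial products 15, 105, 1155 and so on.\<close>

lemma totient_n0: "totient (3 * 5 * 7 * 11 * 13 * 17 * 19 * 23 :: nat) = 36495360"
proof -
  have step: "totient (a * p) = totient a * (p - 1)" if "prime p" "\<not> p dvd a" for a p :: nat
  proof -
    have "coprime a p" using that by (metis coprime_commute prime_imp_coprime)
    then show ?thesis using that by (simp add: totient_mult_coprime totient_prime)
  qed
  have "totient 3 = 2" by (subst totient_prime) simp_all
  then have "totient 15 = 8" using step[of 5 3] by simp
  then have "totient 105 = 48" using step[of 7 15] by simp
  then have "totient 1155 = 480" using step[of 11 105] by simp
  then have "totient 15015 = 5760" using step[of 13 1155] by simp
  then have "totient 255255 = 92160" using step[of 17 15015] by simp
  then have "totient 4849845 = 1658880" using step[of 19 255255] by simp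
  then show ?thesis using step[of 23 4849845] by simp
qed

section \<open>Comparison of the two partitions\<close>

theorem mainTheorem2:
  fixes n0 :: nat and P P' :: "nat set set"
  assumes n0: "n0 = 3 * 5 * 7 * 11 * 13 * 17 * 19 * 23"
    and P: "P = {S_block j n0 | j. j \<ge> 1 \<and> S_block j n0 \<noteq> {}}"
    and P': "P' = {S_block 1 n0 \<union> {n0}, S_block 2 n0 - {n0}} \<union>
                  {S_block j n0 | j. j \<ge> 3 \<and> S_block j n0 \<noteq> {}}"
  shows "n0 = 111546435 \<and>
         partition_on {2..n0} P \<and>
         partition_on {2..n0} P' \<and>
         num_conflicts P' < num_conflicts P \<and>
         \<not> has_min_conflicts {2..n0} P"
proof -
  have val: "n0 = 111546435" using n0 by simp
  have n0_gt: "n0 > 3" and n0_odd: "odd n0" and n0_3: "3 dvd n0" by (simp_all add: val)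
  define A where "A = {2..n0}"
  have n0_A: "n0 \<in> A" using n0_gt by (simp add: A_def)
  have A_ge: "m \<ge> 2" if "m \<in> A" for m using that by (simp add: A_def)
  define f where "f = least_prime_index"
  \<comment> \<open>Relabelling \<open>n0\<close> from 2 to 1 moves it from the second block to the
    first, so the fibres of \<open>g\<close> will be the classes of \<open>P'\<close>.\<close>
  define g where "g = f(n0 := 1)"
  have f1: "f m = 1 \<longleftrightarrow> even m" and f2: "f m = 2 \<longleftrightarrow> odd m \<and> 3 dvd m"
    if "m \<in> A" for m
    using least_prime_index_eq_1 least_prime_index_eq_2 A_ge[OF that] by (simp_all add: f_def)
  have f_ge: "f m \<ge> 1" if "m \<in> A" for m
    using least_prime_index_eq_iff[OF A_ge[OF that], of "f m"] by (simp add: f_def)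
  have f_n0: "f n0 = 2" using f2 n0_A n0_odd n0_3 by simp
  have block: "S_block j n0 = {m \<in> A. f m = j}" if "j \<ge> 1" for j
    using S_block_eq_fibre[OF that] by (simp add: A_def f_def)

  have P_fibres: "P = fibres f A"
  proof -
    have "j \<ge> 1" if "{y \<in> A. f y = j} \<noteq> {}" for j using that f_ge by auto
    then show ?thesis unfolding P fibres_eq using block by blast
  qed
  have P'_fibres: "P' = fibres g A"
  proof -
    have g1: "{y \<in> A. g y = 1} = S_block 1 n0 \<union> {n0}"
      using n0_A by (auto simp: block g_def)
    have g2: "{y \<in> A. g y = 2} = S_block 2 n0 - {n0}"
      by (auto simp: block g_def)
    have g3: "{y \<in> A. g y = j} = S_block j n0" if "j \<ge> 3" for j
      using that f_n0 by (auto simp: block g_def)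
    \<comment> \<open>\<open>P'\<close> lists its first two classes unconditionally, while fibres
      are never empty; the element 3 shows that the second class survives the removal of
      \<open>n0\<close>.\<close>
    have "3 \<in> S_block 2 n0 - {n0}"
      using n0_gt f2[of 3] by (simp add: block A_def)
    then have ne: "{y \<in> A. g y = 1} \<noteq> {}" "{y \<in> A. g y = 2} \<noteq> {}"
      unfolding g1 g2 by blast+
    have cases: "j = 1 \<or> j = 2 \<or> j \<ge> 3" if "{y \<in> A. g y = j} \<noteq> {}" for j
    proof -
      have "j \<ge> 1" using that f_ge by (auto simp: g_def split: if_splits)
      then show ?thesis by linarith
    qed
    show ?thesis
    proof (intro equalityI subsetI)
      fix X assume "X \<in> P'"
      then consider "X = {y \<in> A. g y = 1}" | "X = {y \<in> A. g y = 2}"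
        | j where "j \<ge> 3" "X = {y \<in> A. g y = j}" "X \<noteq> {}"
        unfolding P' g1 g2 using g3 by blast
      then show "X \<in> fibres g A"
        unfolding fibres_eq using ne by cases blast+
    next
      fix X assume "X \<in> fibres g A"
      then obtain j where j: "X = {y \<in> A. g y = j}" "X \<noteq> {}"
        unfolding fibres_eq by blast
      then consider "j = 1" | "j = 2" | "j \<ge> 3" using cases by blast
      then show "X \<in> P'"
        by cases (use j g1 g2 g3 in \<open>auto simp: P'\<close>)
    qed
  qed

  \<comment> \<open>Even friends and even enemies of \<open>n0\<close>, the rest of its old class,
    and its odd friends not divisible by 3. The last set is in conflict with \<open>n0\<close> under
    both labellings, so its size cancels.\<close>
  let ?EF = "{m \<in> A. even m \<and> \<not> coprime n0 m}" and ?EE = "{m \<in> A. even m \<and> coprime n0 m}"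
    and ?S = "{m \<in> A. odd m \<and> 3 dvd m} - {n0}"
    and ?T = "{m \<in> A. odd m \<and> \<not> 3 dvd m \<and> \<not> coprime n0 m}"
  have fin: "finite A" by (simp add: A_def)
  have "?EE \<union> ?EF = {m \<in> A. even m}" by auto
  moreover have "card (?EE \<union> ?EF) = card ?EE + card ?EF"
    by (rule card_Un_disjoint) (use fin in auto)
  ultimately have "card ?EE + card ?EF = n0 div 2"
    using card_even_atLeastAtMost[of n0] by (simp add: A_def)
  moreover have "2 * card ?EE = 36495360"
    using card_even_coprime[of n0] n0_odd n0_gt totient_n0 n0 by (simp add: A_def)
  \<comment> \<open>The subtracted 1 accounts for \<open>n0\<close>, itself an odd multiple of
    3.\<close>
  moreover have "card ?S = (n0 + 3) div 6 - 1"
    using card_odd_multiples_3[of n0] n0_A n0_odd n0_3 by (simp add: A_def)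
  ultimately have count: "card ?EE + card ?S < card ?EF"
    by (simp add: val)

  have friends_iff: "friends n0 m \<longleftrightarrow> m \<noteq> n0 \<and> \<not> coprime n0 m"
    and enemies_iff: "enemies n0 m \<longleftrightarrow> m \<noteq> n0 \<and> coprime n0 m" if "m \<in> A" for m
  proof -
    have "gcd n0 m > 0" using n0_gt by simp
    then have "gcd n0 m > 1 \<longleftrightarrow> gcd n0 m \<noteq> 1" by linarith
    then show "friends n0 m \<longleftrightarrow> m \<noteq> n0 \<and> \<not> coprime n0 m"
      "enemies n0 m \<longleftrightarrow> m \<noteq> n0 \<and> coprime n0 m"
      using A_ge[OF that] n0_gt unfolding friends_def enemies_def coprime_iff_gcd_eq_1 by auto
  qed
  have not_cop: "\<not> coprime n0 m" if "3 dvd m" for m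
    using n0_3 that by (metis coprime_common_divisor_nat num.distinct(3) numeral_eq_one_iff)
  \<comment> \<open>All of the old class is divisible by 3, as is \<open>n0\<close>, so it contains
    no enemy of \<open>n0\<close>; the conflicts are exactly the friends outside it.\<close>
  have "{b. in_conflict (fibres f A) n0 b} = ?EF \<union> ?T"
  proof (intro set_eqI)
    fix m show "m \<in> {b. in_conflict (fibres f A) n0 b} \<longleftrightarrow> m \<in> ?EF \<union> ?T"
      using f2[of m] f_n0 n0_A n0_odd n0_3 friends_iff[of m] enemies_iff[of m] not_cop[of m]
      unfolding in_conflict_fibres by auto
  qed
  moreover have "card (?EF \<union> ?T) = card ?EF + card ?T"
    by (rule card_Un_disjoint) (use fin in auto)
  \<comment> \<open>Among the even numbers \<open>n0\<close> conflicts with its enemies, and every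
    odd friend, including the old class, now lies in another class.\<close>
  moreover have "{b. in_conflict (fibres g A) n0 b} = ?EE \<union> ?S \<union> ?T"
  proof (intro set_eqI)
    fix m show "m \<in> {b. in_conflict (fibres g A) n0 b} \<longleftrightarrow> m \<in> ?EE \<union> ?S \<union> ?T"
      using f1[of m] n0_A n0_odd n0_3 friends_iff[of m] enemies_iff[of m] not_cop[of m]
      unfolding in_conflict_fibres g_def by auto
  qed
  moreover have "card (?EE \<union> ?S \<union> ?T) \<le> card ?EE + card ?S + card ?T"
    by (meson add_le_mono1 card_Un_le le_trans)
  ultimately have less: "num_conflicts P' < num_conflicts P"
    unfolding P_fibres P'_fibres using count
    by (intro num_conflicts_fibres_less[where x = n0] fin) (auto simp: g_def)
  have "partition_on {2..n0} P" "partition_on {2..n0} P'"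
    unfolding P_fibres P'_fibres A_def[symmetric] by (rule partition_on_fibres)+
  then show ?thesis
    using val less unfolding has_min_conflicts_def by (meson not_less)
qed

end
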